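(* Let $a>0$ and consider the system $\dot x=ax+yz,\ \dot y=ay+xz,\ \dot z=z-xy$ on $\mathbb{R}^3$. There exists a unique fixed point, located at the origin, and it is globally repelling.
   Context: A fixed point is globally repelling if it is globally attracting for the time-reversed flow, i.e. every orbit tends to it as $t\to-\infty$. *)

theory Defs
  imports "HOL-Analysis.Analysis"
begin

definition vfield :: "real \<Rightarrow> real^3 \<Rightarrow> real^3" where
  "vfield a v = vector [a * v$1 + v$2 * v$3, a * v$2 + v$1 * v$3, v$3 - v$1 * v$2]"

definition fixed_point :: "('a::real_normed_vector \<Rightarrow> 'a) \<Rightarrow> 'a \<Rightarrow> bool" where
  "fixed_point f p \<longleftrightarrow> f p = 0"

(* Only the values of x on J are relevant. The system is autonomous, so taking 0 as the
   initial time loses no generality. *)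
definition solution_on :: "('a::real_normed_vector \<Rightarrow> 'a) \<Rightarrow> (real \<Rightarrow> 'a) \<Rightarrow> real set \<Rightarrow> bool" where
  "solution_on f x J \<longleftrightarrow> open J \<and> is_interval J \<and> 0 \<in> J \<and>
     (\<forall>t\<in>J. (x has_vector_derivative f (x t)) (at t))"

definition maximal_solution :: "('a::real_normed_vector \<Rightarrow> 'a) \<Rightarrow> (real \<Rightarrow> 'a) \<Rightarrow> real set \<Rightarrow> bool" where
  "maximal_solution f x J \<longleftrightarrow> solution_on f x J \<and>
     (\<forall>y K. solution_on f y K \<and> J \<subseteq> K \<and> (\<forall>t\<in>J. y t = x t) \<longrightarrow> K = J)"

(* An orbit is the trajectory of a maximal solution. The first conjunct after the fixed point
   condition prevents the quantification over orbits from being vacuous; the inclusion {..0} in J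
   says that orbits do not blow up in backward time, so that the limit at -infinity is meaningful. *)
definition globally_repelling :: "('a::real_normed_vector \<Rightarrow> 'a) \<Rightarrow> 'a \<Rightarrow> bool" where
  "globally_repelling f p \<longleftrightarrow> fixed_point f p \<and>
     (\<forall>x0. (\<exists>x J. maximal_solution f x J \<and> x 0 = x0) \<and>
           (\<forall>x J. maximal_solution f x J \<and> x 0 = x0 \<longrightarrow>
                  {..0} \<subseteq> J \<and> (x \<longlongrightarrow> p) at_bot))"

end

(* Along every orbit, the quadratic terms of the field cancel in the derivative of
   V = x^2 + y^2 + 2 z^2, leaving V' = 2 (a x^2 + a y^2 + 2 z^2). Hence
   2 min(a,1) V <= V' <= 2 max(a,1) V: the upper bound excludes blow-up in finite time, so that maximal
   solutions are defined on the whole line, and the lower bound forces V to decay exponentially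
   as t tends to -infinity. Existence on (-T,T) comes from Picard's theorem for the field truncated
   by the radial projection onto a large ball, which the solution does not leave before time T. *)

theory Submission
  imports Defs
begin

section \<open>Picard's theorem for globally Lipschitz fields on a Banach space\<close>

text \<open>The signed integral from 0 to \<open>t\<close>: integrals over reversed intervals
  vanish, so at most one of the two terms contributes.\<close>

definition primitive :: "(real \<Rightarrow> 'a::banach) \<Rightarrow> real \<Rightarrow> 'a" where
  "primitive h t = integral {0..t} h - integral {t..0} h"

lemma primitive_0 [simp]: "primitive h 0 = 0"
  by (simp add: primitive_def)

lemma primitive_has_vector_derivative:
  fixes h :: "real \<Rightarrow> 'a::banach"
  assumes h: "continuous_on UNIV h"
  shows "(primitive h has_vector_derivative h t) (at t)"
proof -
  \<comment> \<open>With this \<open>T\<close>, both 0 and \<open>t\<close> are interior to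
    \<open>{-T..T}\<close>, so the single base point \<open>-T\<close> serves for either sign of
    \<open>t\<close>.\<close>
  define T where "T = \<bar>t\<bar> + 1"
  have int: "h integrable_on {p..q}" for p q
    by (rule integrable_continuous_real) (rule continuous_on_subset[OF h], simp)
  have eq: "primitive h s = integral {-T..s} h - integral {-T..0} h" if "s \<in> {-T<..<T}" for s
  proof (cases "0 \<le> s")
    case True
    then have "integral {-T..0} h + integral {0..s} h = integral {-T..s} h"
      using int by (intro Henstock_Kurzweil_Integration.integral_combine) (auto simp: T_def)
    moreover have "integral {s..0} h = 0"
      using True by (cases "s = 0") auto
    ultimately show ?thesis by (simp add: primitive_def algebra_simps)
  next
    case False
    then have "integral {-T..s} h + integral {s..0} h = integral {-T..0} h"
      using int that by (intro Henstock_Kurzweil_Integration.integral_combine) auto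
    then show ?thesis using False by (simp add: primitive_def algebra_simps)
  qed
  have "((\<lambda>s. integral {-T..s} h) has_vector_derivative h t) (at t within {-T..T})"
    by (rule integral_has_vector_derivative[OF continuous_on_subset[OF h]]) (auto simp: T_def)
  moreover have "at t within {-T..T} = at t"
    by (rule at_within_interior) (auto simp: T_def)
  ultimately have "((\<lambda>s. integral {-T..s} h - integral {-T..0} h) has_vector_derivative h t) (at t)"
    by (auto intro!: derivative_eq_intros)
  then show ?thesis
    by (rule has_vector_derivative_transform_within_open[of _ _ _ "{-T<..<T}"])
       (use eq in \<open>auto simp: T_def\<close>)
qed

text \<open>Integrating the bound on the derivative from 0 to \<open>t\<close> gives
  \<open>B / K * (exp (K * \<bar>t\<bar>) - 1)\<close>. The gain of a factor \<open>1 / K\<close> is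
  what later turns the Picard operator into a contraction.\<close>

lemma norm_le_exp_abs_of_derivative_le:
  fixes F :: "real \<Rightarrow> 'a::real_normed_vector"
  assumes F: "\<And>t. (F has_vector_derivative h t) (at t)" and "F 0 = 0"
    and h: "\<And>t. norm (h t) \<le> B * exp (K * \<bar>t\<bar>)" and "K > 0"
  shows "norm (F t) \<le> B / K * exp (K * \<bar>t\<bar>)"
proof -
  have "0 \<le> norm (h 0)" by simp
  also have "\<dots> \<le> B" using h[of 0] by simp
  finally have B: "B \<ge> 0" .
  have cont: "continuous_on S F" for S
    using F by (auto intro!: continuous_at_imp_continuous_on has_vector_derivative_continuous)
  consider "t = 0" | "t > 0" | "t < 0" by linarith
  then show ?thesis
  proof cases
    case 1
    then show ?thesis using B assms by simp
  next
    case 2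
    have "norm (F t - F 0) \<le> B / K * exp (K * t) - B / K * exp (K * 0)"
    proof (rule differentiable_bound_general[OF 2, where \<phi>' = "\<lambda>s. B * exp (K * s)"
          and f' = h])
      show "((\<lambda>s. B / K * exp (K * s)) has_vector_derivative B * exp (K * s)) (at s)" for s
        unfolding has_real_derivative_iff_has_vector_derivative[symmetric]
        using \<open>K > 0\<close> by (auto intro!: derivative_eq_intros)
      show "norm (h s) \<le> B * exp (K * s)" if "0 < s" for s
        using h[of s] that by simp
    qed (use \<open>K > 0\<close> in \<open>auto intro!: continuous_intros cont F\<close>)
    then show ?thesis using 2 B \<open>K > 0\<close> \<open>F 0 = 0\<close>
      by (simp add: algebra_simps) (smt (verit) divide_nonneg_pos)
  next
    case 3
    have "norm (F 0 - F t) \<le> - B / K * exp (- K * 0) - - B / K * exp (- K * t)"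
    proof (rule differentiable_bound_general[OF 3, where \<phi>' = "\<lambda>s. B * exp (- K * s)"
          and f' = h])
      show "((\<lambda>s. - B / K * exp (- K * s)) has_vector_derivative B * exp (- K * s)) (at s)" for s
        unfolding has_real_derivative_iff_has_vector_derivative[symmetric]
        using \<open>K > 0\<close> by (auto intro!: derivative_eq_intros)
      show "norm (h s) \<le> B * exp (- K * s)" if "s < 0" for s
        using h[of s] that by simp
    qed (use \<open>K > 0\<close> in \<open>auto intro!: continuous_intros cont F\<close>)
    then show ?thesis using 3 B \<open>K > 0\<close> \<open>F 0 = 0\<close>
      by (simp add: algebra_simps) (smt (verit) divide_nonneg_pos)
  qed
qed

text \<open>Banach's fixed point theorem is applied to \<open>u = x / w\<close>, which ranges over
  the complete space of bounded continuous functions when \<open>x\<close> grows at most like the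
  weight \<open>w\<close>.\<close>

theorem lipschitz_global_solution:
  fixes g :: "'a::banach \<Rightarrow> 'a"
  assumes g: "L-lipschitz_on UNIV g"
  obtains x where "x 0 = x0" "\<And>t. (x has_vector_derivative g (x t)) (at t)"
proof -
  have L: "L \<ge> 0" using g by (rule lipschitz_on_nonneg)
  \<comment> \<open>Positive even for \<open>L = 0\<close>, and large enough for the contraction
    constant \<open>L / K\<close> to be at most 1/2.\<close>
  define K where "K = 2 * L + 1"
  have K: "K > 0" "L / K \<le> 1 / 2" using L by (auto simp: K_def field_simps)
  \<comment> \<open>Dividing by this weight makes the Picard operator a contraction on the whole line at once.\<close>
  define w where "w t = exp (K * \<bar>t\<bar>)" for t :: real
  have w: "w t > 0" "w t \<ge> 1" for t using K by (auto simp: w_def)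
  have cont_w: "continuous_on UNIV w" unfolding w_def by (intro continuous_intros)
  define h where "h u t = g (w t *\<^sub>R apply_bcontfun u t)" for u :: "real \<Rightarrow>\<^sub>C 'a" and t
  have cont_g: "continuous_on S g" for S
    using lipschitz_on_continuous_on[OF g] continuous_on_subset by blast
  have cont_h: "continuous_on UNIV (h u)" for u
    unfolding h_def
    by (rule continuous_on_compose2[OF cont_g[of UNIV]]) (auto intro!: continuous_intros cont_w)
  have h_diff: "norm (h u t - h v t) \<le> L * dist u v * exp (K * \<bar>t\<bar>)" for u v t
  proof -
    have "norm (h u t - h v t) \<le> L * norm (w t *\<^sub>R (apply_bcontfun u t - apply_bcontfun v t))"
      using lipschitz_on_normD[OF g] by (simp add: h_def scaleR_diff_right)
    also have "\<dots> = L * (w t * dist (apply_bcontfun u t) (apply_bcontfun v t))"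
      using w[of t] by (simp add: dist_norm)
    also have "\<dots> \<le> L * (w t * dist u v)"
      using w[of t] L by (intro mult_left_mono dist_bounded) auto
    finally show ?thesis by (simp add: w_def mult_ac)
  qed
  have P_diff: "norm (primitive (h u) t - primitive (h v) t) \<le> L * dist u v / K * exp (K * \<bar>t\<bar>)"
    for u v t
    by (rule norm_le_exp_abs_of_derivative_le[where h = "\<lambda>t. h u t - h v t"])
       (auto intro!: derivative_eq_intros primitive_has_vector_derivative cont_h h_diff K)
  \<comment> \<open>The Picard operator sending \<open>x\<close> to \<open>x0\<close> plus the
    integral of \<open>g\<close> along \<open>x\<close>, conjugated by multiplication by
    \<open>w\<close>.\<close>
  define \<Phi> where "\<Phi> u t = (x0 + primitive (h u) t) /\<^sub>R w t" for u t
  have cont_\<Phi>: "continuous_on UNIV (\<Phi> u)" for u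
  proof -
    have "continuous_on UNIV (primitive (h u))"
      by (intro continuous_at_imp_continuous_on ballI
          has_vector_derivative_continuous[OF primitive_has_vector_derivative] cont_h)
    moreover have "w t \<noteq> 0" for t using w[of t] by simp
    ultimately show ?thesis
      unfolding \<Phi>_def by (auto intro!: continuous_intros cont_w)
  qed
  have \<Phi>_diff: "dist (\<Phi> u t) (\<Phi> v t) \<le> L / K * dist u v" for u v t
  proof -
    have "dist (\<Phi> u t) (\<Phi> v t) = norm (primitive (h u) t - primitive (h v) t) / w t"
      using w[of t] by (simp add: \<Phi>_def dist_norm scaleR_diff_right[symmetric] divide_inverse_commute)
    also have "\<dots> \<le> (L * dist u v / K * w t) / w t"
      using w[of t] P_diff[of u t v] by (intro divide_right_mono) (auto simp: w_def)
    finally show ?thesis using w[of t] by simp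
  qed
  have bdd: "bounded (range (\<Phi> u))" for u
  proof -
    \<comment> \<open>A Lipschitz \<open>g\<close> has at most linear growth, and the constant
      \<open>norm (g 0)\<close> is absorbed using \<open>w t \<ge> 1\<close>.\<close>
    define B where "B = norm (g 0) + L * norm u"
    have hb: "norm (h u t) \<le> B * exp (K * \<bar>t\<bar>)" for t
    proof -
      have "norm (h u t) \<le> norm (g 0) + norm (h u t - g 0)"
        by (metis add.commute diff_add_cancel norm_triangle_ineq)
      also have "norm (h u t - g 0) \<le> L * (w t * norm (apply_bcontfun u t))"
        using lipschitz_on_normD[OF g, of "w t *\<^sub>R apply_bcontfun u t" 0] w[of t] by (simp add: h_def)
      also have "\<dots> \<le> L * (w t * norm u)"
        using w[of t] L by (intro mult_left_mono norm_bounded) auto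
      also have "norm (g 0) \<le> w t * norm (g 0)"
        using w[of t] by (simp add: mult_le_cancel_right1)
      finally show ?thesis by (simp add: B_def w_def algebra_simps)
    qed
    have "norm (\<Phi> u t) \<le> norm x0 + B / K" for t
    proof -
      have "norm (primitive (h u) t) \<le> B / K * w t"
        unfolding w_def
        by (rule norm_le_exp_abs_of_derivative_le[OF primitive_has_vector_derivative[OF cont_h]])
           (auto intro: hb K)
      moreover have "norm x0 \<le> norm x0 * w t"
        using w[of t] by (simp add: mult_le_cancel_left1)
      ultimately have "norm (x0 + primitive (h u) t) \<le> (norm x0 + B / K) * w t"
        using norm_triangle_ineq[of x0 "primitive (h u) t"] by (simp add: algebra_simps)
      moreover have "norm (\<Phi> u t) = norm (x0 + primitive (h u) t) / w t"
        using w[of t] by (simp add: \<Phi>_def divide_inverse_commute)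
      ultimately show ?thesis using w[of t] by (simp add: pos_divide_le_eq)
    qed
    then show ?thesis by (auto simp: bounded_iff)
  qed
  \<comment> \<open>Continuity and boundedness ensure that the conversion \<open>Bcontfun\<close>
    really represents \<open>\<Phi> u\<close>.\<close>
  have app: "apply_bcontfun (Bcontfun (\<Phi> u)) = \<Phi> u" for u
    using cont_\<Phi> bdd by (intro Bcontfun_inverse) (auto simp: bcontfun_def)
  have "\<exists>!u. Bcontfun (\<Phi> u) = u"
  proof (rule banach_fix_type)
    show "\<forall>u v. dist (Bcontfun (\<Phi> u)) (Bcontfun (\<Phi> v)) \<le> L / K * dist u v"
      by (intro allI dist_bound, unfold app, rule \<Phi>_diff)
  qed (use K L in auto)
  then obtain u where u: "Bcontfun (\<Phi> u) = u" by blast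
  define x where "x t = x0 + primitive (h u) t" for t
  have x: "x t = w t *\<^sub>R apply_bcontfun u t" for t
    using w[of t] app[of u] by (simp add: u x_def \<Phi>_def)
  show ?thesis
  proof
    show "x 0 = x0" by (simp add: x_def)
    show "(x has_vector_derivative g (x t)) (at t)" for t
    proof -
      have "h u t = g (x t)" by (simp add: h_def x)
      then show ?thesis
        using primitive_has_vector_derivative[OF cont_h, of u t]
        by (auto simp: x_def[abs_def] intro!: derivative_eq_intros)
    qed
  qed
qed

section \<open>Gronwall estimates, uniqueness and gluing of solutions\<close>

text \<open>The differential inequality makes \<open>\<phi> r * exp (- c * r)\<close> nondecreasing,
  whatever the signs of \<open>c\<close> and \<open>\<phi>\<close>.\<close>

lemma gronwall_lower:
  fixes \<phi> :: "real \<Rightarrow> real"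
  assumes "s \<le> t"
    and \<phi>: "\<And>r. s \<le> r \<Longrightarrow> r \<le> t \<Longrightarrow> (\<phi> has_real_derivative \<phi>' r) (at r)"
    and ge: "\<And>r. s \<le> r \<Longrightarrow> r \<le> t \<Longrightarrow> c * \<phi> r \<le> \<phi>' r"
  shows "\<phi> s * exp (c * (t - s)) \<le> \<phi> t"
proof -
  have "\<phi> s * exp (- c * s) \<le> \<phi> t * exp (- c * t)"
  proof (rule DERIV_nonneg_imp_nondecreasing[OF \<open>s \<le> t\<close>])
    fix r assume r: "s \<le> r" "r \<le> t"
    have "((\<lambda>r. \<phi> r * exp (- c * r)) has_real_derivative (\<phi>' r - c * \<phi> r) * exp (- c * r)) (at r)"
      by (auto intro!: derivative_eq_intros \<phi>[OF r] simp: algebra_simps)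
    then show "\<exists>y. ((\<lambda>r. \<phi> r * exp (- c * r)) has_real_derivative y) (at r) \<and> 0 \<le> y"
      using ge[OF r] by (auto intro!: exI)
  qed
  then have "\<phi> s * exp (- c * s) * exp (c * t) \<le> \<phi> t * exp (- c * t) * exp (c * t)"
    by (rule mult_right_mono) simp
  then show ?thesis by (simp add: mult.assoc exp_add[symmetric] algebra_simps)
qed

text \<open>Forward in time the previous lemma is applied to \<open>- \<phi>\<close> with rate
  \<open>c\<close>, backward in time to \<open>\<phi>\<close> with rate \<open>- c\<close>.\<close>

lemma gronwall_abs:
  fixes \<phi> :: "real \<Rightarrow> real"
  assumes \<phi>: "\<And>r. r \<in> closed_segment 0 t \<Longrightarrow> (\<phi> has_real_derivative \<phi>' r) (at r)"
    and le: "\<And>r. r \<in> closed_segment 0 t \<Longrightarrow> \<bar>\<phi>' r\<bar> \<le> c * \<phi> r"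
  shows "\<phi> t \<le> \<phi> 0 * exp (c * \<bar>t\<bar>)"
proof (cases "0 \<le> t")
  case True
  have "- \<phi> 0 * exp (c * (t - 0)) \<le> - \<phi> t"
  proof (rule gronwall_lower[OF True])
    fix r assume "0 \<le> r" "r \<le> t"
    then have r: "r \<in> closed_segment 0 t" by (simp add: closed_segment_eq_real_ivl)
    show "((\<lambda>r. - \<phi> r) has_real_derivative - \<phi>' r) (at r)"
      by (intro derivative_intros \<phi>[OF r])
    show "c * - \<phi> r \<le> - \<phi>' r" using le[OF r] by simp
  qed
  then show ?thesis using True by simp
next
  case False
  have "\<phi> t * exp (- c * (0 - t)) \<le> \<phi> 0"
  proof (rule gronwall_lower)
    fix r assume "t \<le> r" "r \<le> 0"
    then have r: "r \<in> closed_segment 0 t" by (simp add: closed_segment_eq_real_ivl)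
    show "(\<phi> has_real_derivative \<phi>' r) (at r)" by (rule \<phi>[OF r])
    show "- c * \<phi> r \<le> \<phi>' r" using le[OF r] by simp
  qed (use False in simp)
  then have "\<phi> t * exp (c * t) * exp (- c * t) \<le> \<phi> 0 * exp (- c * t)"
    by (intro mult_right_mono) auto
  then show ?thesis using False by (simp add: mult.assoc exp_add[symmetric])
qed

lemma has_real_derivative_norm_squared:
  fixes x :: "real \<Rightarrow> 'a::real_inner"
  assumes "(x has_vector_derivative x') (at t)"
  shows "((\<lambda>t. (norm (x t))\<^sup>2) has_real_derivative 2 * inner (x t) x') (at t)"
proof -
  have "((\<lambda>t. inner (x t) (x t)) has_derivative
         (\<lambda>h. inner (x t) (h *\<^sub>R x') + inner (h *\<^sub>R x') (x t))) (at t)"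
    using assms unfolding has_vector_derivative_def by (intro has_derivative_inner)
  then show ?thesis
    unfolding power2_norm_eq_inner has_field_derivative_def
    by (rule has_derivative_eq_rhs) (simp add: fun_eq_iff inner_commute)
qed

text \<open>On the compact segment from 0 to \<open>t\<close> both trajectories stay in one ball,
  where \<open>f\<close> is Lipschitz. Gronwall then applies to their squared distance, which is 0
  at time 0.\<close>

lemma solution_on_unique:
  fixes f :: "'a::real_inner \<Rightarrow> 'a"
  assumes lip: "\<And>R. \<exists>L. L-lipschitz_on (cball 0 R) f"
    and x: "solution_on f x J" and y: "solution_on f y K"
    and eq: "x 0 = y 0" and t: "t \<in> J" "t \<in> K"
  shows "x t = y t"
proof -
  have "convex J" "convex K" "0 \<in> J" "0 \<in> K"
    using x y by (simp_all add: solution_on_def is_interval_convex)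
  then have sub: "closed_segment 0 t \<subseteq> J" "closed_segment 0 t \<subseteq> K"
    using t by (simp_all add: closed_segment_subset)
  have dx: "(x has_vector_derivative f (x r)) (at r)"
    and dy: "(y has_vector_derivative f (y r)) (at r)" if "r \<in> closed_segment 0 t" for r
    using x y sub that by (auto simp: solution_on_def)
  have "compact (x ` closed_segment 0 t \<union> y ` closed_segment 0 t)"
    by (intro compact_Un compact_continuous_image compact_segment continuous_at_imp_continuous_on ballI)
       (auto intro: has_vector_derivative_continuous dx dy)
  then have "bounded (x ` closed_segment 0 t \<union> y ` closed_segment 0 t)"
    by (rule compact_imp_bounded)
  then obtain R where "\<forall>v\<in>x ` closed_segment 0 t \<union> y ` closed_segment 0 t. norm v \<le> R"
    unfolding bounded_iff by blast
  then have R: "x r \<in> cball 0 R" "y r \<in> cball 0 R" if "r \<in> closed_segment 0 t" for r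
    using that by (simp_all add: ball_Un)
  obtain L where L: "L-lipschitz_on (cball 0 R) f" using lip by blast
  have "(norm (x t - y t))\<^sup>2 \<le> (norm (x 0 - y 0))\<^sup>2 * exp (2 * L * \<bar>t\<bar>)"
  proof (rule gronwall_abs)
    fix r assume r: "r \<in> closed_segment 0 t"
    show "((\<lambda>r. (norm (x r - y r))\<^sup>2) has_real_derivative
            2 * inner (x r - y r) (f (x r) - f (y r))) (at r)"
      by (intro has_real_derivative_norm_squared has_vector_derivative_diff dx[OF r] dy[OF r])
    have "\<bar>inner (x r - y r) (f (x r) - f (y r))\<bar> \<le> norm (x r - y r) * norm (f (x r) - f (y r))"
      by (rule Cauchy_Schwarz_ineq2)
    also have "\<dots> \<le> norm (x r - y r) * (L * norm (x r - y r))"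
      using lipschitz_on_normD[OF L R[OF r]] by (intro mult_left_mono) auto
    finally show "\<bar>2 * inner (x r - y r) (f (x r) - f (y r))\<bar> \<le> 2 * L * (norm (x r - y r))\<^sup>2"
      by (simp add: power2_eq_square mult_ac abs_mult)
  qed
  then show ?thesis by (simp add: eq)
qed

text \<open>By uniqueness, the solutions on the intervals \<open>{-T<..<T}\<close> agree wherever
  two of them are defined, so they glue together.\<close>

lemma global_solution_of_local_solutions:
  fixes f :: "'a::real_inner \<Rightarrow> 'a"
  assumes lip: "\<And>R. \<exists>L. L-lipschitz_on (cball 0 R) f"
    and ex: "\<And>T. T > 0 \<Longrightarrow> \<exists>x. solution_on f x {-T<..<T} \<and> x 0 = x0"
  obtains x where "solution_on f x UNIV" "x 0 = x0"
proof -
  obtain X where X: "\<And>T. T > 0 \<Longrightarrow> solution_on f (X T) {-T<..<T} \<and> X T 0 = x0"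
    using ex by metis
  \<comment> \<open>The value at \<open>t\<close> is read off a solution whose interval contains
    \<open>t\<close>.\<close>
  define x where "x t = X (\<bar>t\<bar> + 1) t" for t
  have x: "x t = X T t" if "t \<in> {-T<..<T}" for t T
    unfolding x_def
    by (rule solution_on_unique[OF lip, where x = "X (\<bar>t\<bar> + 1)" and y = "X T" and J = "{-(\<bar>t\<bar> + 1)<..<\<bar>t\<bar> + 1}"
        and K = "{-T<..<T}"])
       (use that X[of "\<bar>t\<bar> + 1"] X[of T] in auto)
  have "(x has_vector_derivative f (x t)) (at t)" for t
  proof -
    define T where "T = \<bar>t\<bar> + 1"
    have t: "t \<in> {-T<..<T}" by (auto simp: T_def)
    have "(X T has_vector_derivative f (x t)) (at t)"
      using X[of T] t x[OF t] by (auto simp: solution_on_def T_def)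
    then show ?thesis
      by (rule has_vector_derivative_transform_within_open[OF _ _ t]) (auto simp: x)
  qed
  then have "solution_on f x UNIV" by (simp add: solution_on_def)
  moreover have "x 0 = x0" using X[of 1] by (simp add: x_def)
  ultimately show ?thesis by (rule that)
qed

section \<open>Truncation by projection onto a ball\<close>

text \<open>The projection is radial: \<open>c\<close> is 1 inside the ball and
  \<open>R / norm v\<close> outside. Only the bounds on \<open>c\<close> matter later, for the
  Lyapunov estimate of the truncated field.\<close>

lemma closest_point_cball_0:
  fixes v :: "'a::euclidean_space"
  assumes "R \<ge> 0"
  obtains c where "0 \<le> c" "c \<le> 1" "closest_point (cball 0 R) v = c *\<^sub>R v"
proof (cases "norm v \<le> R")
  case True
  then show ?thesis by (intro that[of 1]) (auto intro!: closest_point_self)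
next
  case False
  then have v: "norm v > 0" using assms by linarith
  have "(R / norm v) *\<^sub>R v = closest_point (cball 0 R) v"
  proof (rule closest_point_unique)
    show "\<forall>z\<in>cball 0 R. dist v ((R / norm v) *\<^sub>R v) \<le> dist v z"
    proof
      fix z :: 'a assume z: "z \<in> cball 0 R"
      have "v - (R / norm v) *\<^sub>R v = (1 - R / norm v) *\<^sub>R v" by (simp add: algebra_simps)
      then have "dist v ((R / norm v) *\<^sub>R v) = \<bar>1 - R / norm v\<bar> * norm v"
        by (simp add: dist_norm)
      also have "\<dots> = norm v - R" using False v by (simp add: field_simps)
      also have "\<dots> \<le> norm v - norm z" using z by simp
      also have "\<dots> \<le> dist v z" by (simp add: dist_norm norm_triangle_ineq2)
      finally show "dist v ((R / norm v) *\<^sub>R v) \<le> dist v z" .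
    qed
  qed (use assms v in auto)
  then show ?thesis using False v assms by (intro that[of "R / norm v"]) auto
qed

text \<open>Projection onto a closed convex set is nonexpansive, so a Lipschitz bound on the set
  becomes a global one with the same constant.\<close>

lemma lipschitz_on_closest_point_comp:
  fixes f :: "'a::euclidean_space \<Rightarrow> 'b::metric_space"
  assumes "L-lipschitz_on S f" "convex S" "closed S" "S \<noteq> {}"
  shows "L-lipschitz_on UNIV (\<lambda>v. f (closest_point S v))"
proof (rule lipschitz_onI)
  fix v w
  have "dist (f (closest_point S v)) (f (closest_point S w))
      \<le> L * dist (closest_point S v) (closest_point S w)"
    using assms by (intro lipschitz_onD[OF assms(1)] closest_point_in_set)
  also have "\<dots> \<le> L * dist v w"
    using assms lipschitz_on_nonneg by (intro mult_left_mono closest_point_lipschitz) auto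
  finally show "dist (f (closest_point S v)) (f (closest_point S w)) \<le> L * dist v w" .
qed (use assms(1) in \<open>rule lipschitz_on_nonneg\<close>)

section \<open>The vector field and its Lyapunov function\<close>

lemma vfield_lipschitz_on_cball: "\<exists>L. L-lipschitz_on (cball 0 R) (vfield a)"
proof (cases "R \<ge> 0")
  case True
  \<comment> \<open>Summing over components, the linear terms contribute
    \<open>2 * \<bar>a\<bar> + 1\<close> and each of the three products contributes
    \<open>2 * R\<close>.\<close>
  define L where "L = 2 * \<bar>a\<bar> + 1 + 6 * R"
  have "L-lipschitz_on (cball 0 R) (vfield a)"
  proof (rule lipschitz_onI)
    fix v w :: "real^3" assume "v \<in> cball 0 R" "w \<in> cball 0 R"
    then have R: "\<bar>v $ i\<bar> \<le> R" "\<bar>w $ i\<bar> \<le> R" for i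
      by (auto intro: order_trans[OF component_le_norm_cart])
    define d where "d = dist v w"
    have d: "\<bar>v $ i - w $ i\<bar> \<le> d" for i
      using component_le_norm_cart[of "v - w" i] by (simp add: d_def dist_norm)
    have lin: "\<bar>b * v $ i - b * w $ i\<bar> \<le> \<bar>b\<bar> * d" for b i
    proof -
      have "\<bar>b * v $ i - b * w $ i\<bar> = \<bar>b\<bar> * \<bar>v $ i - w $ i\<bar>"
        by (simp add: abs_mult[symmetric] algebra_simps)
      then show ?thesis using d by (simp add: mult_left_mono)
    qed
    have quad: "\<bar>v $ i * v $ j - w $ i * w $ j\<bar> \<le> 2 * R * d" for i j
    proof -
      have "v $ i * v $ j - w $ i * w $ j
          = v $ i * (v $ j - w $ j) + w $ j * (v $ i - w $ i)"
        by (simp add: algebra_simps)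
      then have "\<bar>v $ i * v $ j - w $ i * w $ j\<bar>
          \<le> \<bar>v $ i\<bar> * \<bar>v $ j - w $ j\<bar> + \<bar>w $ j\<bar> * \<bar>v $ i - w $ i\<bar>"
        by (metis abs_mult abs_triangle_ineq)
      also have "\<dots> \<le> R * d + R * d"
        using R d True by (intro add_mono mult_mono) auto
      finally show ?thesis by simp
    qed
    have "dist (vfield a v) (vfield a w) \<le> (\<Sum>i\<in>UNIV. \<bar>(vfield a v - vfield a w) $ i\<bar>)"
      unfolding dist_norm by (rule norm_le_l1_cart)
    also have "\<dots> \<le> (\<bar>a\<bar> * d + 2 * R * d) + (\<bar>a\<bar> * d + 2 * R * d) + (\<bar>1\<bar> * d + 2 * R * d)"
      unfolding sum_3 vfield_def vector_minus_component vector_3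
    proof (intro add_mono)
      show "\<bar>a * v $ 1 + v $ 2 * v $ 3 - (a * w $ 1 + w $ 2 * w $ 3)\<bar> \<le> \<bar>a\<bar> * d + 2 * R * d"
        using lin[of a 1] quad[of 2 3] by linarith
      show "\<bar>a * v $ 2 + v $ 1 * v $ 3 - (a * w $ 2 + w $ 1 * w $ 3)\<bar> \<le> \<bar>a\<bar> * d + 2 * R * d"
        using lin[of a 2] quad[of 1 3] by linarith
      show "\<bar>v $ 3 - v $ 1 * v $ 2 - (w $ 3 - w $ 1 * w $ 2)\<bar> \<le> \<bar>1\<bar> * d + 2 * R * d"
        using lin[of 1 3] quad[of 1 2] by linarith
    qed
    finally show "dist (vfield a v) (vfield a w) \<le> L * dist v w"
      by (simp add: L_def d_def algebra_simps)
  qed (use True in \<open>simp add: L_def\<close>)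
  then show ?thesis by blast
\<comment> \<open>For negative \<open>R\<close> the ball is empty and the constant 0 works.\<close>
qed (auto intro!: exI[of _ 0])

text \<open>The weight 2 on the third square makes the cubic terms of the derivative, 2xyz + 2xyz -
  4xyz, cancel.\<close>

definition lyapunov :: "real^3 \<Rightarrow> real" where
  "lyapunov v = (v$1)\<^sup>2 + (v$2)\<^sup>2 + 2 * (v$3)\<^sup>2"

lemma norm_squared_le_lyapunov: "(norm v)\<^sup>2 \<le> lyapunov v"
  unfolding power2_norm_eq_inner
  by (simp add: inner_vec_def sum_3 lyapunov_def power2_eq_square)

lemma lyapunov_nonneg: "0 \<le> lyapunov v"
  by (simp add: lyapunov_def)

text \<open>The quadratic terms of the field do not contribute, whatever the scaling \<^term>\<open>c\<close>; this is what
  makes the Lyapunov estimates hold for the radially truncated field as well.\<close>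

lemma lyapunov_has_derivative:
  assumes "(x has_vector_derivative vfield a (c *\<^sub>R x t)) (at t)"
  shows "((\<lambda>t. lyapunov (x t)) has_real_derivative
           2 * c * (a * (x t $ 1)\<^sup>2 + a * (x t $ 2)\<^sup>2 + 2 * (x t $ 3)\<^sup>2)) (at t)"
proof -
  have comp: "((\<lambda>t. x t $ i) has_real_derivative vfield a (c *\<^sub>R x t) $ i) (at t)" for i
    using bounded_linear.has_vector_derivative[OF bounded_linear_vec_nth assms]
    by (simp add: has_real_derivative_iff_has_vector_derivative)
  show ?thesis
    unfolding lyapunov_def
    by (rule derivative_eq_intros comp refl)+
       (simp add: vfield_def power2_eq_square algebra_simps)
qed

text \<open>The middle expression is \<open>lyapunov v\<close> with each square multiplied by the
  matching eigenvalue \<open>a\<close>, \<open>a\<close> or 1 of the linear part.\<close>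

lemma lyapunov_rate_bounds:
  assumes "a > 0"
  shows "min a 1 * lyapunov v \<le> a * (v $ 1)\<^sup>2 + a * (v $ 2)\<^sup>2 + 2 * (v $ 3)\<^sup>2"
    and "a * (v $ 1)\<^sup>2 + a * (v $ 2)\<^sup>2 + 2 * (v $ 3)\<^sup>2 \<le> max a 1 * lyapunov v"
proof -
  have "min a 1 * (v$1)\<^sup>2 \<le> a * (v$1)\<^sup>2" "min a 1 * (v$2)\<^sup>2 \<le> a * (v$2)\<^sup>2"
    "min a 1 * (v$3)\<^sup>2 \<le> 1 * (v$3)\<^sup>2" "a * (v$1)\<^sup>2 \<le> max a 1 * (v$1)\<^sup>2"
    "a * (v$2)\<^sup>2 \<le> max a 1 * (v$2)\<^sup>2" "1 * (v$3)\<^sup>2 \<le> max a 1 * (v$3)\<^sup>2"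
    by (intro mult_right_mono; simp)+
  then show "min a 1 * lyapunov v \<le> a * (v $ 1)\<^sup>2 + a * (v $ 2)\<^sup>2 + 2 * (v $ 3)\<^sup>2"
    and "a * (v $ 1)\<^sup>2 + a * (v $ 2)\<^sup>2 + 2 * (v $ 3)\<^sup>2 \<le> max a 1 * lyapunov v"
    by (auto simp: lyapunov_def distrib_left)
qed

section \<open>Global existence and maximal solutions\<close>

lemma vfield_solution_on_interval:
  assumes a: "a > 0" and "T > 0"
  shows "\<exists>x. solution_on (vfield a) x {-T<..<T} \<and> x 0 = x0"
proof -
  define M where "M = 2 * max a 1"
  \<comment> \<open>The bound on the norm that Gronwall gives up to time \<open>T\<close>; with it
    the truncation is inactive on \<open>{-T<..<T}\<close>.\<close>
  define R where "R = sqrt (lyapunov x0 * exp (M * T))"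
  have R: "R \<ge> 0" by (simp add: R_def lyapunov_nonneg)
  define P where "P = closest_point (cball 0 R :: (real^3) set)"
  obtain L where "L-lipschitz_on (cball 0 R) (vfield a)"
    using vfield_lipschitz_on_cball by blast
  then have "L-lipschitz_on UNIV (\<lambda>v. vfield a (P v))"
    unfolding P_def using R by (intro lipschitz_on_closest_point_comp) auto
  then obtain x where x0: "x 0 = x0"
    and x: "\<And>t. (x has_vector_derivative vfield a (P (x t))) (at t)"
    by (rule lipschitz_global_solution[where ?x0.0 = x0]) blast
  \<comment> \<open>The bound is proved for the truncated field, since \<open>x\<close> is not yet
    known to stay in the ball. The factor \<open>c\<close> lies between 0 and 1, so it can only slow
    the growth.\<close>
  have V: "lyapunov (x t) \<le> lyapunov x0 * exp (M * \<bar>t\<bar>)" for t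
  proof -
    obtain c where c: "\<And>v. 0 \<le> c v" "\<And>v. c v \<le> 1" "\<And>v. P v = c v *\<^sub>R v"
      unfolding P_def using closest_point_cball_0[OF R] by metis
    define q where "q v = a * (v $ 1)\<^sup>2 + a * (v $ 2)\<^sup>2 + 2 * (v $ 3)\<^sup>2" for v :: "real^3"
    have "lyapunov (x t) \<le> lyapunov (x 0) * exp (M * \<bar>t\<bar>)"
    proof (rule gronwall_abs)
      fix r
      show "((\<lambda>r. lyapunov (x r)) has_real_derivative 2 * c (x r) * q (x r)) (at r)"
        \<comment> \<open>The scaling enters the derivative only at the time \<open>r\<close>, so it
          may depend on the position \<open>x r\<close>.\<close>
        unfolding q_def using x[of r] c(3) by (intro lyapunov_has_derivative) simp
      have q: "0 \<le> q (x r)" using a by (simp add: q_def)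
      have "c (x r) * q (x r) \<le> 1 * q (x r)"
        using c q by (intro mult_right_mono) auto
      also have "\<dots> \<le> max a 1 * lyapunov (x r)"
        using lyapunov_rate_bounds(2)[OF a, of "x r"] by (simp add: q_def)
      finally show "\<bar>2 * c (x r) * q (x r)\<bar> \<le> M * lyapunov (x r)"
        using c(1)[of "x r"] q by (simp add: M_def abs_mult)
    qed
    then show ?thesis by (simp add: x0)
  qed
  have P: "P (x t) = x t" if "t \<in> {-T<..<T}" for t
  proof -
    have "(norm (x t))\<^sup>2 \<le> lyapunov x0 * exp (M * \<bar>t\<bar>)"
      using norm_squared_le_lyapunov V by (rule order_trans)
    also have "\<dots> \<le> lyapunov x0 * exp (M * T)"
      using that by (intro mult_left_mono lyapunov_nonneg) (auto simp: M_def intro!: mult_left_mono)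
    finally have "norm (x t) \<le> R" unfolding R_def by (rule real_le_rsqrt)
    then show ?thesis by (simp add: P_def closest_point_self)
  qed
  have "(x has_vector_derivative vfield a (x t)) (at t)" if "t \<in> {-T<..<T}" for t
    using x[of t] by (simp only: P[OF that])
  then have "solution_on (vfield a) x {-T<..<T}"
    using \<open>T > 0\<close> by (simp add: solution_on_def is_interval_1)
  then show ?thesis using x0 by blast
qed

lemma vfield_global_solution:
  assumes "a > 0"
  obtains x where "solution_on (vfield a) x UNIV" "x 0 = x0"
  by (rule global_solution_of_local_solutions[OF vfield_lipschitz_on_cball
        vfield_solution_on_interval[OF assms]])

text \<open>By uniqueness, the global solution with the same initial value extends \<open>x\<close>,
  so maximality forces \<open>J = UNIV\<close>. Conversely, \<open>UNIV\<close> has no proper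
  extension.\<close>

lemma maximal_solution_iff_UNIV:
  assumes "a > 0"
  shows "maximal_solution (vfield a) x J \<longleftrightarrow> solution_on (vfield a) x UNIV \<and> J = UNIV"
proof
  assume max: "maximal_solution (vfield a) x J"
  then have x: "solution_on (vfield a) x J" by (simp add: maximal_solution_def)
  obtain y where y: "solution_on (vfield a) y UNIV" "y 0 = x 0"
    using vfield_global_solution[OF assms] .
  have "\<forall>t\<in>J. y t = x t"
    using solution_on_unique[OF vfield_lipschitz_on_cball y(1) x y(2)] by simp
  then have "J = UNIV" using max y(1) unfolding maximal_solution_def by blast
  then show "solution_on (vfield a) x UNIV \<and> J = UNIV" using x by simp
qed (auto simp: maximal_solution_def)

section \<open>Backward decay and the fixed point\<close>

lemma vfield_solution_tendsto_at_bot: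
  assumes a: "a > 0" and x: "solution_on (vfield a) x UNIV"
  shows "(x \<longlongrightarrow> 0) at_bot"
proof -
  define m where "m = 2 * min a 1"
  have m: "m > 0" using a by (simp add: m_def)
  have bound: "(norm (x t))\<^sup>2 \<le> lyapunov (x 0) * exp (m * t)" if "t \<le> 0" for t
  proof -
    \<comment> \<open>Gronwall runs from \<open>t\<close> up to 0: a lower bound on forward growth
      is a rate of decay backward in time.\<close>
    have "lyapunov (x t) * exp (m * (0 - t)) \<le> lyapunov (x 0)"
    proof (rule gronwall_lower[OF that])
      fix r
      show "((\<lambda>r. lyapunov (x r)) has_real_derivative
          2 * 1 * (a * (x r $ 1)\<^sup>2 + a * (x r $ 2)\<^sup>2 + 2 * (x r $ 3)\<^sup>2)) (at r)"
        using x by (intro lyapunov_has_derivative) (simp add: solution_on_def)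
      show "m * lyapunov (x r) \<le> 2 * 1 * (a * (x r $ 1)\<^sup>2 + a * (x r $ 2)\<^sup>2 + 2 * (x r $ 3)\<^sup>2)"
        using lyapunov_rate_bounds(1)[OF a, of "x r"] by (simp add: m_def)
    qed
    then have "lyapunov (x t) * exp (- m * t) * exp (m * t) \<le> lyapunov (x 0) * exp (m * t)"
      by (intro mult_right_mono) auto
    then have "lyapunov (x t) \<le> lyapunov (x 0) * exp (m * t)"
      by (simp add: mult.assoc exp_add[symmetric])
    with norm_squared_le_lyapunov show ?thesis by (rule order_trans)
  qed
  have lim: "((\<lambda>t. lyapunov (x 0) * exp (m * t)) \<longlongrightarrow> 0) at_bot"
    by (rule tendsto_mult_right_zero[OF filterlim_compose[OF exp_at_bot
          filterlim_tendsto_pos_mult_at_bot[OF tendsto_const m filterlim_ident]]])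
  have "((\<lambda>t. (norm (x t))\<^sup>2) \<longlongrightarrow> 0) at_bot"
    by (rule tendsto_sandwich[OF _ _ tendsto_const lim])
       (auto simp: eventually_at_bot_linorder intro: bound)
  then have "((\<lambda>t. sqrt ((norm (x t))\<^sup>2)) \<longlongrightarrow> sqrt 0) at_bot"
    by (rule tendsto_real_sqrt)
  then show ?thesis
    by (simp add: tendsto_norm_zero_iff)
qed

text \<open>A fixed point is a constant solution. Since every solution on the whole line tends to 0
  at minus infinity, the constant must be 0.\<close>

lemma fixed_point_vfield_iff:
  assumes "a > 0"
  shows "fixed_point (vfield a) p \<longleftrightarrow> p = 0"
proof
  assume "fixed_point (vfield a) p"
  then have "((\<lambda>t. p) \<longlongrightarrow> 0) (at_bot :: real filter)"
    by (intro vfield_solution_tendsto_at_bot[OF assms]) (simp add: solution_on_def fixed_point_def)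
  then show "p = 0" by (simp add: tendsto_const_iff)
qed (simp add: fixed_point_def vfield_def vec_eq_iff forall_3)

theorem mainTheorem5:
  fixes a :: real
  assumes "a > 0"
  shows "(\<exists>!p. fixed_point (vfield a) p) \<and> fixed_point (vfield a) 0 \<and>
         globally_repelling (vfield a) 0"
proof -
  have "\<exists>x J. maximal_solution (vfield a) x J \<and> x 0 = x0" for x0
    unfolding maximal_solution_iff_UNIV[OF assms]
    using vfield_global_solution[OF assms, of x0] by blast
  then show ?thesis
    using vfield_solution_tendsto_at_bot[OF assms]
    by (simp add: globally_repelling_def fixed_point_vfield_iff[OF assms])
       (simp add: maximal_solution_iff_UNIV[OF assms])
qed

end
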